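(* For every integer $t\geq 2$ there exists a $2t\times(2t+1)$ acyclic 0--1 pattern $X_t$ such that \[ \operatorname{Ex}(X_t,n)=\Omega\big(n(\log n/\log\log n)^t\big)\quad\text{and}\quad \operatorname{Ex}(X_t,n)=O\big(n\log^{4t-3} n\big). \]
   Context: For a 0--1 matrix $P\in\{0,1\}^{k\times l}$ and $A\in\{0,1\}^{n\times n}$, $A$ contains $P$ (written $P\prec A$) if there are rows $r_1<\cdots<r_k$ and columns $c_1<\cdots<c_l$ of $A$ such that $P(i,j)=1$ implies $A(r_i,c_j)=1$; otherwise $A$ avoids $P$. The extremal function is $\operatorname{Ex}(P,n)=\max\{\|A\|_1 : A\in\{0,1\}^{n\times n},\ P\nprec A\}$, where $\|A\|_1$ is the number of 1s of $A$. A pattern $P$ is acyclic if the bipartite graph whose two vertex classes are the rows and the columns of $P$, with row $i$ adjacent to column $j$ iff $P(i,j)=1$, is a forest. Asymptotics are as $n\to\infty$ with $t$ fixed. *)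

theory Defs
  imports
    Complex_Main
    "HOL-Library.Landau_Symbols"
    "Jordan_Normal_Form.Matrix"
begin

definition binary_mats :: "nat \<Rightarrow> nat \<Rightarrow> nat mat set" where
  "binary_mats k l = {A \<in> carrier_mat k l. \<forall>i<k. \<forall>j<l. A $$ (i, j) \<in> {0, 1}}"

definition num_ones :: "nat mat \<Rightarrow> nat" where
  "num_ones A = card {(i, j). i < dim_row A \<and> j < dim_col A \<and> A $$ (i, j) = 1}"

text \<open>Rows and columns are indexed from 0.\<close>

definition contains_pattern :: "nat mat \<Rightarrow> nat mat \<Rightarrow> bool" (infix "\<prec>\<^sub>p" 50) where
  "P \<prec>\<^sub>p A \<longleftrightarrow> (\<exists>r c :: nat \<Rightarrow> nat.
     strict_mono_on {..<dim_row P} r \<and> r ` {..<dim_row P} \<subseteq> {..<dim_row A} \<and>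
     strict_mono_on {..<dim_col P} c \<and> c ` {..<dim_col P} \<subseteq> {..<dim_col A} \<and>
     (\<forall>i<dim_row P. \<forall>j<dim_col P. P $$ (i, j) = 1 \<longrightarrow> A $$ (r i, c j) = 1))"

text \<open>The maximum is over a nonempty set whenever \<open>P\<close> has a 1-entry; for an all-zero \<open>P\<close> and
  large \<open>n\<close> no matrix avoids \<open>P\<close>, and the value is a fixed unspecified number.\<close>

definition extremal :: "nat mat \<Rightarrow> nat \<Rightarrow> nat" where
  "extremal P n = Max {num_ones A | A. A \<in> binary_mats n n \<and> \<not> P \<prec>\<^sub>p A}"

text \<open>Cycles and forests of the simple undirected graph with symmetric, irreflexive adjacency
  relation \<open>adj\<close>. The digraph notion of forest is unsuitable: it counts both orientations of
  an edge as a cycle.\<close>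

definition graph_cycle :: "('v \<Rightarrow> 'v \<Rightarrow> bool) \<Rightarrow> 'v list \<Rightarrow> bool" where
  "graph_cycle adj vs \<longleftrightarrow> 3 \<le> length vs \<and> distinct vs \<and>
     (\<forall>i<length vs. adj (vs ! i) (vs ! (Suc i mod length vs)))"

definition graph_forest :: "('v \<Rightarrow> 'v \<Rightarrow> bool) \<Rightarrow> bool" where
  "graph_forest adj \<longleftrightarrow> \<not> (\<exists>vs. graph_cycle adj vs)"

text \<open>\<open>Inl i\<close> is the vertex of row \<open>i\<close>, \<open>Inr j\<close> that of column \<open>j\<close>. Elements of the vertex type
  outside the index range are isolated and do not affect acyclicity.\<close>

fun pattern_adj :: "nat mat \<Rightarrow> nat + nat \<Rightarrow> nat + nat \<Rightarrow> bool" where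
  "pattern_adj P (Inl i) (Inr j) \<longleftrightarrow> i < dim_row P \<and> j < dim_col P \<and> P $$ (i, j) = 1"
| "pattern_adj P (Inr j) (Inl i) \<longleftrightarrow> i < dim_row P \<and> j < dim_col P \<and> P $$ (i, j) = 1"
| "pattern_adj P (Inl i) (Inl i') \<longleftrightarrow> False"
| "pattern_adj P (Inr j) (Inr j') \<longleftrightarrow> False"

definition acyclic_pattern :: "nat mat \<Rightarrow> bool" where
  "acyclic_pattern P \<longleftrightarrow> graph_forest (pattern_adj P)"

lemma finite_num_ones_avoiding:
  "finite {num_ones A | A. A \<in> binary_mats n n \<and> \<not> P \<prec>\<^sub>p A}"
proof (rule finite_subset)
  show "{num_ones A | A. A \<in> binary_mats n n \<and> \<not> P \<prec>\<^sub>p A} \<subseteq> {..n * n}"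
  proof
    fix x assume "x \<in> {num_ones A | A. A \<in> binary_mats n n \<and> \<not> P \<prec>\<^sub>p A}"
    then obtain A where x: "x = num_ones A" and "A \<in> binary_mats n n" by blast
    then have "{(i, j). i < dim_row A \<and> j < dim_col A \<and> A $$ (i, j) = 1} \<subseteq> {..<n} \<times> {..<n}"
      by (auto simp: binary_mats_def)
    from card_mono[OF _ this] show "x \<in> {..n * n}"
      by (simp add: x num_ones_def card_cartesian_product)
  qed
qed simp

lemma zero_mat_avoids:
  assumes "i < dim_row P" "j < dim_col P" "P $$ (i, j) = 1"
  shows "0\<^sub>m n n \<in> binary_mats n n" "\<not> P \<prec>\<^sub>p 0\<^sub>m n n"
proof -
  show "0\<^sub>m n n \<in> binary_mats n n" by (simp add: binary_mats_def)
  show "\<not> P \<prec>\<^sub>p 0\<^sub>m n n"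
  proof
    assume "P \<prec>\<^sub>p 0\<^sub>m n n"
    then obtain r c :: "nat \<Rightarrow> nat" where
      "r ` {..<dim_row P} \<subseteq> {..<n}" "c ` {..<dim_col P} \<subseteq> {..<n}"
      "0\<^sub>m n n $$ (r i, c j) = (1 :: nat)"
      using assms unfolding contains_pattern_def by auto
    moreover from this assms have "r i < n" "c j < n" by auto
    ultimately show False by simp
  qed
qed

end

theory Submission
  imports Defs "HOL-Real_Asymp.Real_Asymp"
begin

text \<open>The pattern \<open>X\<^sub>t\<close> has a 1 in the corner \<open>(0, 0)\<close>, at \<open>(0, p)\<close> and \<open>(p, 0)\<close> for odd \<open>p\<close>,
  and at \<open>(p, p + 1)\<close> and \<open>(p + 1, p)\<close> for odd \<open>p\<close>.

  Upper bound: the last rows and columns of \<open>X\<^sub>t\<close> can be stripped off one by one, each of them containing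
  a single 1 at that moment and costing one factor \<open>log n\<close>. After \<open>4t - 3\<close> steps a \<open>2 \<times> 2\<close> pattern
  of linear extremal function remains.

  Lower bound: put a 1 at \<open>(i, j)\<close> iff \<open>i + j + code k = n - 1\<close> for a word \<open>k\<close> of length \<open>t\<close> over
  \<open>{0..<m}\<close>, where \<open>m\<close> is of order \<open>log n / log log n\<close>. In an occurrence of \<open>X\<^sub>t\<close> every 1 carries a
  word. The distance between two columns that share a row is a difference of two codes, and its size
  reveals the index of the first letter in which the two words differ, the larger of the two
  letters and the common prefix; the same holds for rows. Comparing with the word of the corner,
  one finds that each successive odd \<open>p\<close> forces the word at \<open>(0, p)\<close>, and the one at \<open>(p, 0)\<close>, to
  differ from it in an earlier letter, so that after \<open>t\<close> rounds there is no letter left.\<close>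

section \<open>Stripping leaf rows and columns\<close>

text \<open>\<open>U\<close> is an infinite pattern cut to its first \<open>p\<close> rows and
  \<open>q\<close> columns, so that lines are appended merely by increasing \<open>p\<close> or
  \<open>q\<close>.\<close>

definition embeds :: "(nat \<Rightarrow> nat \<Rightarrow> bool) \<Rightarrow> nat \<Rightarrow> nat \<Rightarrow> nat \<Rightarrow> (nat \<times> nat) set \<Rightarrow> bool" where
  "embeds U p q n M \<longleftrightarrow> (\<exists>r c :: nat \<Rightarrow> nat.
     strict_mono_on {..<p} r \<and> r ` {..<p} \<subseteq> {..<n} \<and>
     strict_mono_on {..<q} c \<and> c ` {..<q} \<subseteq> {..<n} \<and>
     (\<forall>i<p. \<forall>j<q. U i j \<longrightarrow> (r i, c j) \<in> M))"

definition weight_bound :: "(nat \<Rightarrow> nat \<Rightarrow> bool) \<Rightarrow> nat \<Rightarrow> nat \<Rightarrow> nat \<Rightarrow> nat \<Rightarrow> bool" where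
  "weight_bound U p q n W \<longleftrightarrow>
     (\<forall>M \<subseteq> {..<n} \<times> {..<n}. \<not> embeds U p q n M \<longrightarrow> card M \<le> W)"

lemma embeds_converse:
  assumes "\<And>i j. U i j \<longleftrightarrow> U j i" "embeds U p q n (M\<inverse>)"
  shows "embeds U q p n M"
proof -
  from assms(2) obtain r c where rc: "strict_mono_on {..<p} r" "r ` {..<p} \<subseteq> {..<n}"
     "strict_mono_on {..<q} c" "c ` {..<q} \<subseteq> {..<n}"
     "\<forall>i<p. \<forall>j<q. U i j \<longrightarrow> (r i, c j) \<in> M\<inverse>"
    unfolding embeds_def by blast
  show ?thesis unfolding embeds_def
    by (rule exI[of _ c], rule exI[of _ r]) (use rc assms(1) in auto)
qed

lemma weight_bound_converse:
  assumes "\<And>i j. U i j \<longleftrightarrow> U j i" "weight_bound U p q n W"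
  shows "weight_bound U q p n W"
  unfolding weight_bound_def
proof (intro allI impI)
  fix M :: "(nat \<times> nat) set" assume M: "M \<subseteq> {..<n} \<times> {..<n}" "\<not> embeds U q p n M"
  then have "\<not> embeds U p q n (M\<inverse>)" using embeds_converse[of U p q n M] assms(1) by blast
  moreover have "M\<inverse> \<subseteq> {..<n} \<times> {..<n}" using M by auto
  ultimately have "card (M\<inverse>) \<le> W" using assms(2) unfolding weight_bound_def by blast
  then show "card M \<le> W" by simp
qed

text \<open>The 1s that are not last in their row are classified by the dyadic scale \<open>k\<close> of their distance
  to the last 1 of the row. Inside one class, the entries at \<open>(i', j)\<close> and \<open>(i', q - 1)\<close> are less
  than \<open>2 ^ k\<close> apart, whereas the last 1 in row \<open>i\<^sub>0\<close> is at least \<open>2 ^ k\<close> to the right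
  of column \<open>j\<close>; so it can play the role of the new column \<open>q\<close>.\<close>

lemma weight_bound_append_leaf_column:
  assumes W: "weight_bound U p q n W"
    and leaf: "\<And>i. i < p \<Longrightarrow> U i q \<Longrightarrow> i = i0"
    and q: "0 < q" "j < q" "i0 < p" "i' < p"
    and U: "U i0 j" "U i' j" "U i' (q - 1)"
    and L: "n \<le> 2 ^ L"
  shows "weight_bound U p (Suc q) n (n + L * W)"
  unfolding weight_bound_def
proof (intro allI impI)
  fix M :: "(nat \<times> nat) set"
  assume M: "M \<subseteq> {..<n} \<times> {..<n}" and avoid: "\<not> embeds U p (Suc q) n M"
  define last where "last x = Max {y. (x, y) \<in> M}" for x
  have fin: "finite {y. (x, y) \<in> M}" for x
    by (rule finite_subset[of _ "{..<n}"]) (use M in auto)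
  have last_in: "(x, last x) \<in> M" and last_ge: "y \<le> last x" if "(x, y) \<in> M" for x y
    using Max_in[OF fin[of x]] Max_ge[OF fin[of x], of y] that by (auto simp: last_def)
  define C where "C k = {(x, y) \<in> M. 2 ^ k \<le> last x - y \<and> last x - y < 2 ^ Suc k}" for k
  have card_C: "card (C k) \<le> W" for k
  proof (rule ccontr)
    assume "\<not> card (C k) \<le> W"
    moreover have "C k \<subseteq> {..<n} \<times> {..<n}" using M by (auto simp: C_def)
    ultimately have "embeds U p q n (C k)" using W unfolding weight_bound_def by blast
    then obtain r c where rc: "strict_mono_on {..<p} r" "r ` {..<p} \<subseteq> {..<n}"
       "strict_mono_on {..<q} c" "c ` {..<q} \<subseteq> {..<n}"
       and all: "\<forall>i<p. \<forall>j<q. U i j \<longrightarrow> (r i, c j) \<in> C k"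
      unfolding embeds_def by (elim exE conjE)
    have in_C: "(r i0, c j) \<in> C k" "(r i', c j) \<in> C k" "(r i', c (q - 1)) \<in> C k"
      using all q U by simp_all
    then have in_M: "(r i0, last (r i0)) \<in> M" using last_in[of "r i0" "c j"] by (simp add: C_def)
    have "2 ^ k \<le> last (r i0) - c j" "last (r i') - c j < 2 * 2 ^ k"
      "2 ^ k \<le> last (r i') - c (q - 1)" "(0::nat) < 2 ^ k"
      using in_C by (simp_all add: C_def)
    then have beyond: "c (q - 1) < last (r i0)" by linarith
    define c' where "c' = c(q := last (r i0))"
    have c_le: "c x \<le> c (q - 1)" if "x < q" for x
    proof (cases "x = q - 1")
      case False
      then have "c x < c (q - 1)" using that q(1) by (intro strict_mono_onD[OF rc(3)]) auto
      then show ?thesis by simp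
    qed simp
    have "strict_mono_on {..<Suc q} c'"
    proof (rule strict_mono_onI)
      fix x y assume "x \<in> {..<Suc q}" "y \<in> {..<Suc q}" "x < y"
      then show "c' x < c' y"
        using strict_mono_onD[OF rc(3), of x y] c_le[of x] beyond by (auto simp: c'_def)
    qed
    moreover have "c' ` {..<Suc q} \<subseteq> {..<n}"
      using rc(4) in_M M by (auto simp: c'_def less_Suc_eq image_subset_iff)
    moreover have "(r i, c' j) \<in> M" if "i < p" "j < Suc q" "U i j" for i j
    proof (cases "j = q")
      case True
      then show ?thesis using leaf that in_M by (auto simp: c'_def)
    next
      case False
      then show ?thesis using all that by (auto simp: c'_def C_def)
    qed
    ultimately have "embeds U p (Suc q) n M" unfolding embeds_def using rc(1,2) by blast
    then show False using avoid by blast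
  qed
  \<comment> \<open>The last 1s of the rows account for the summand \<open>n\<close>. Any other 1 is
    at distance at least 1 and less than \<open>n \<le> 2 ^ L\<close> from the last one, so
    \<open>L\<close> scales suffice.\<close>
  have cover: "M \<subseteq> (\<lambda>x. (x, last x)) ` {..<n} \<union> (\<Union>k<L. C k)"
  proof
    fix z assume "z \<in> M"
    then obtain x y where z: "z = (x, y)" "(x, y) \<in> M" by (cases z) auto
    then have xy: "x < n" "y \<le> last x" "last x < n" using M last_in last_ge by auto
    show "z \<in> (\<lambda>x. (x, last x)) ` {..<n} \<union> (\<Union>k<L. C k)"
    proof (cases "y = last x")
      case False
      then obtain k where k: "2 ^ k \<le> last x - y" "last x - y < 2 ^ (k + 1)"
        using ex_power_ivl1[of 2 "last x - y"] xy by (auto simp: Suc_le_eq)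
      have "(2::nat) ^ k < 2 ^ L" using k xy L by linarith
      then have "k < L" by simp
      then show ?thesis using k z by (auto simp: C_def)
    qed (use z xy in auto)
  qed
  have finC: "finite (C k)" for k
    by (rule finite_subset[of _ "{..<n} \<times> {..<n}"]) (use M in \<open>auto simp: C_def\<close>)
  have "card M \<le> card ((\<lambda>x. (x, last x)) ` {..<n} \<union> (\<Union>k<L. C k))"
    by (rule card_mono[OF _ cover]) (use finC in auto)
  also have "\<dots> \<le> card ((\<lambda>x. (x, last x)) ` {..<n}) + card (\<Union>k<L. C k)" by (rule card_Un_le)
  also have "card ((\<lambda>x. (x, last x)) ` {..<n}) \<le> n" using card_image_le[of "{..<n}"] by simp
  also have "card (\<Union>k<L. C k) \<le> (\<Sum>k<L. card (C k))" by (rule card_UN_le) simp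
  also have "\<dots> \<le> L * W" using sum_bounded_above[of "{..<L}" "\<lambda>k. card (C k)" W] card_C by simp
  finally show "card M \<le> n + L * W" by simp
qed

section \<open>Corners of the pattern and their upper bounds\<close>

text \<open>Taken on all indices, because the patterns met while stripping are its top left corners.
  Its symmetry turns each column step into a row step.\<close>

definition arrow :: "nat \<Rightarrow> nat \<Rightarrow> bool" where
  "arrow i j \<longleftrightarrow> i = 0 \<and> j = 0 \<or> i = 0 \<and> odd j \<or> odd i \<and> j = 0
     \<or> odd i \<and> j = Suc i \<or> odd j \<and> i = Suc j"

lemma arrow_commute: "arrow i j \<longleftrightarrow> arrow j i"
  by (auto simp: arrow_def)

text \<open>The 1s of this corner are (0, 0), (0, 1) and (1, 0). A 1 that is last neither in its row
  nor in its column starts an occurrence, and at most \<open>2 * n\<close> entries are last in a row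
  or a column.\<close>

lemma weight_bound_arrow_2_2: "weight_bound arrow 2 2 n (2 * n)"
  unfolding weight_bound_def
proof (intro allI impI)
  fix M :: "(nat \<times> nat) set"
  assume M: "M \<subseteq> {..<n} \<times> {..<n}" and avoid: "\<not> embeds arrow 2 2 n M"
  have "M \<subseteq> (\<lambda>x. (x, Max {y. (x, y) \<in> M})) ` {..<n} \<union> (\<lambda>y. (Max {x. (x, y) \<in> M}, y)) ` {..<n}"
  proof (rule ccontr)
    assume "\<not> ?thesis"
    then obtain x y where xy: "(x, y) \<in> M" "y \<noteq> Max {y. (x, y) \<in> M}" "x \<noteq> Max {x. (x, y) \<in> M}"
      using M by blast
    have fin: "finite {y. (x, y) \<in> M}" "finite {x. (x, y) \<in> M}"
      by (rule finite_subset[of _ "{..<n}"], use M in auto)+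
    obtain y' where y': "y < y'" "(x, y') \<in> M"
      using Max_in[OF fin(1)] Max_ge[OF fin(1), of y] xy by (auto simp: order_less_le)
    obtain x' where x': "x < x'" "(x', y) \<in> M"
      using Max_in[OF fin(2)] Max_ge[OF fin(2), of x] xy by (auto simp: order_less_le)
    have "embeds arrow 2 2 n M" unfolding embeds_def
      by (rule exI[of _ "\<lambda>i. if i = 0 then x else x'"], rule exI[of _ "\<lambda>i. if i = 0 then y else y'"])
        (use x' y' xy M in \<open>auto simp: arrow_def numeral_2_eq_2 less_Suc_eq intro!: strict_mono_onI\<close>)
    then show False using avoid by blast
  qed
  then have "card M \<le> card ((\<lambda>x. (x, Max {y. (x, y) \<in> M})) ` {..<n} \<union> (\<lambda>y. (Max {x. (x, y) \<in> M}, y)) ` {..<n})"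
    by (intro card_mono) auto
  also have "\<dots> \<le> card ((\<lambda>x. (x, Max {y. (x, y) \<in> M})) ` {..<n}) + card ((\<lambda>y. (Max {x. (x, y) \<in> M}, y)) ` {..<n})"
    by (rule card_Un_le)
  also have "\<dots> \<le> n + n"
    by (intro add_mono; rule order_trans[OF card_image_le]) auto
  finally show "card M \<le> 2 * n" by simp
qed

text \<open>For even \<open>q\<close> the new 1 lies in row \<open>q - 1\<close>, which has to be
  present, whence \<open>q \<le> p\<close>. For odd \<open>q\<close> it lies in row 0, and
  \<open>p \<le> Suc q\<close> keeps out row \<open>q + 1\<close>, which would add a second
  1.\<close>

lemma weight_bound_arrow_append_column:
  assumes W: "weight_bound arrow p q n W" "n \<le> W" "1 \<le> L" "n \<le> 2 ^ L"
    and pq: "2 \<le> q" "q \<le> p \<or> odd q \<and> q \<le> Suc p" "p \<le> Suc q"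
  shows "weight_bound arrow p (Suc q) n (2 * L * W)"
proof -
  have "weight_bound arrow p (Suc q) n (n + L * W)"
  proof (cases "even q")
    case True
    then obtain l where "q = 2 * l" by blast
    then obtain k where q: "q = Suc (Suc (2 * k))" using pq(1) by (cases l) auto
    show ?thesis
    proof (rule weight_bound_append_leaf_column[OF W(1), where ?i0.0 = "Suc (2 * k)" and j = 0 and i' = 0])
      show "\<And>i. i < p \<Longrightarrow> arrow i q \<Longrightarrow> i = Suc (2 * k)"
        by (auto simp: arrow_def q)
    qed (use q pq W in \<open>auto simp: arrow_def\<close>)
  next
    case False
    then obtain l where "q = 2 * l + 1" by (auto elim: oddE)
    then obtain k where q: "q = Suc (Suc (Suc (2 * k)))" using pq(1) by (cases l) auto
    show ?thesis
    \<comment> \<open>Now row 0 receives the new 1, so the two 1s in columns 0 and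
      \<open>q - 1\<close> are taken from row \<open>q - 2\<close>.\<close>
    proof (rule weight_bound_append_leaf_column[OF W(1), where ?i0.0 = 0 and j = 0 and i' = "Suc (2 * k)"])
      show "\<And>i. i < p \<Longrightarrow> arrow i q \<Longrightarrow> i = 0"
        using pq by (auto simp: arrow_def q)
    qed (use q pq W in \<open>auto simp: arrow_def\<close>)
  qed
  \<comment> \<open>Absorbing \<open>n\<close> into a factor 2 leaves a pure product, which
    iterates.\<close>
  moreover have "n \<le> L * W" using W(2,3) by (metis le_trans mult_le_mono1 nat_mult_1)
  then have "n + L * W \<le> 2 * L * W" by simp
  ultimately show ?thesis unfolding weight_bound_def by (meson le_trans)
qed

lemma weight_bound_arrow_append_row:
  assumes "weight_bound arrow p q n W" "n \<le> W" "1 \<le> L" "n \<le> 2 ^ L"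
    and "2 \<le> p" "p \<le> q \<or> odd p \<and> p \<le> Suc q" "q \<le> Suc p"
  shows "weight_bound arrow (Suc p) q n (2 * L * W)"
  using weight_bound_arrow_append_column[OF weight_bound_converse[OF arrow_commute assms(1)] assms(2-7)]
  by (rule weight_bound_converse[OF arrow_commute])

text \<open>One column step from the 2 x 2 corner gives exponent 1. Passing from \<open>t\<close> to
  \<open>Suc t\<close> appends row \<open>2 * t\<close>, column \<open>2 * t + 1\<close>, row
  \<open>2 * t + 1\<close> and column \<open>2 * t + 2\<close>; in this order each line has a single
  1 when it arrives. This raises the exponent by 4.\<close>

lemma weight_bound_arrow:
  assumes L: "1 \<le> L" "n \<le> 2 ^ L" and t: "1 \<le> t"
  shows "weight_bound arrow (2 * t) (2 * t + 1) n (2 * n * (2 * L) ^ (4 * t - 3))"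
  using t
proof (induction t rule: dec_induct)
  case base
  show ?case using weight_bound_arrow_append_column[OF weight_bound_arrow_2_2 _ L]
    by (simp add: mult_ac numeral_3_eq_3 numeral_2_eq_2)
next
  case (step t)
  define W where "W k = 2 * n * (2 * L) ^ (4 * t - 3 + k)" for k
  have n_le: "n \<le> W k" for k
  proof -
    have "1 \<le> (2 * L) ^ (4 * t - 3 + k)" using L by simp
    then have "n * 1 \<le> n * (2 * (2 * L) ^ (4 * t - 3 + k))" by (intro mult_le_mono) simp_all
    then show ?thesis by (simp add: W_def mult_ac)
  qed
  have W_Suc: "2 * L * W k = W (Suc k)" for k by (simp add: W_def mult_ac)
  have "weight_bound arrow (2 * t) (Suc (2 * t)) n (W 0)" using step.IH by (simp add: W_def)
  then have "weight_bound arrow (Suc (2 * t)) (Suc (2 * t)) n (W (Suc 0))"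
    unfolding W_Suc[symmetric]
    by (rule weight_bound_arrow_append_row[OF _ n_le L]) (use step.hyps in simp_all)
  then have "weight_bound arrow (Suc (2 * t)) (Suc (Suc (2 * t))) n (W (Suc (Suc 0)))"
    unfolding W_Suc[of "Suc 0", symmetric]
    by (rule weight_bound_arrow_append_column[OF _ n_le L]) (use step.hyps in simp_all)
  then have "weight_bound arrow (Suc (Suc (2 * t))) (Suc (Suc (2 * t))) n (W (Suc (Suc (Suc 0))))"
    unfolding W_Suc[of "Suc (Suc 0)", symmetric]
    by (rule weight_bound_arrow_append_row[OF _ n_le L]) (use step.hyps in simp_all)
  then have "weight_bound arrow (Suc (Suc (2 * t))) (Suc (Suc (Suc (2 * t)))) n (W (Suc (Suc (Suc (Suc 0)))))"
    unfolding W_Suc[of "Suc (Suc (Suc 0))", symmetric]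
    by (rule weight_bound_arrow_append_column[OF _ n_le L]) (use step.hyps in simp_all)
  moreover have "4 * t - 3 + Suc (Suc (Suc (Suc 0))) = 4 * Suc t - 3" using step.hyps by simp
  moreover have "2 * Suc t = Suc (Suc (2 * t))" "2 * Suc t + 1 = Suc (Suc (Suc (2 * t)))" by simp_all
  ultimately show ?case by (simp only: W_def)
qed

section \<open>The pattern as a matrix\<close>

text \<open>On a cycle, the two neighbours of a vertex of maximal depth both have smaller depth, so
  they coincide; but they are distinct since the length is at least 3.\<close>

lemma graph_forest_if_unique_parent:
  fixes depth :: "'v \<Rightarrow> nat"
  assumes sym: "\<And>u v. adj u v \<Longrightarrow> adj v u"
    and neq: "\<And>u v. adj u v \<Longrightarrow> depth u \<noteq> depth v"
    and unique: "\<And>u v w. adj u v \<Longrightarrow> adj u w \<Longrightarrow> depth v < depth u \<Longrightarrow> depth w < depth u \<Longrightarrow> v = w"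
  shows "graph_forest adj"
  unfolding graph_forest_def
proof
  assume "\<exists>vs. graph_cycle adj vs"
  then obtain vs where len: "3 \<le> length vs" and dist: "distinct vs"
    and adj: "\<And>i. i < length vs \<Longrightarrow> adj (vs ! i) (vs ! (Suc i mod length vs))"
    unfolding graph_cycle_def by blast
  let ?n = "length vs"
  obtain i where i: "i < ?n" and max: "\<And>k. k < ?n \<Longrightarrow> depth (vs ! k) \<le> depth (vs ! i)"
  proof -
    have "Max ((\<lambda>k. depth (vs ! k)) ` {..<?n}) \<in> (\<lambda>k. depth (vs ! k)) ` {..<?n}"
      using len by (intro Max_in) (auto simp: lessThan_empty_iff)
    then obtain i where "i < ?n" "Max ((\<lambda>k. depth (vs ! k)) ` {..<?n}) = depth (vs ! i)" by auto
    then show ?thesis using that Max_ge[of "(\<lambda>k. depth (vs ! k)) ` {..<?n}"] by force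
  qed
  define a where "a = Suc i mod ?n"
  define b where "b = (if i = 0 then ?n - 1 else i - 1)"
  have ab: "a < ?n" "b < ?n" "Suc b mod ?n = i" using i len by (auto simp: a_def b_def intro!: mod_less_divisor)
  have "a \<noteq> b" using i len by (cases "Suc i = ?n") (auto simp: a_def b_def)
  have 1: "adj (vs ! i) (vs ! a)" using adj[OF i] by (simp add: a_def)
  have 2: "adj (vs ! i) (vs ! b)" using sym[OF adj[OF ab(2)]] ab(3) by simp
  have "vs ! a = vs ! b"
    using unique[OF 1 2] neq[OF 1] neq[OF 2] max[OF ab(1)] max[OF ab(2)] by simp
  then show False using \<open>a \<noteq> b\<close> ab dist by (simp add: nth_eq_iff_index_eq)
qed

definition arrow_mat :: "nat \<Rightarrow> nat mat" where
  "arrow_mat t = mat (2 * t) (2 * t + 1) (\<lambda>(i, j). if arrow i j then 1 else 0)"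

lemma arrow_mat_binary: "arrow_mat t \<in> binary_mats (2 * t) (2 * t + 1)"
  by (auto simp: binary_mats_def arrow_mat_def)

lemma acyclic_arrow_mat: "acyclic_pattern (arrow_mat t)"
  unfolding acyclic_pattern_def
proof (rule graph_forest_if_unique_parent)
  \<comment> \<open>Distance from column 0, taken as the root: its children are row 0 and the odd
    rows, the other columns come next, and the positive even rows are leaves.\<close>
  define depth :: "nat + nat \<Rightarrow> nat" where
    "depth v = (case v of Inl i \<Rightarrow> if i = 0 \<or> odd i then 1 else 3
                        | Inr j \<Rightarrow> if j = 0 then 0 else 2)" for v
  have dim: "dim_row (arrow_mat t) = 2 * t" "dim_col (arrow_mat t) = 2 * t + 1"
    by (simp_all add: arrow_mat_def)
  have adj: "pattern_adj (arrow_mat t) u v \<Longrightarrow> (\<exists>i j. arrow i j \<and> (u = Inl i \<and> v = Inr j \<or> u = Inr j \<and> v = Inl i))"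
    for u v
    by (cases u; cases v) (auto simp: dim arrow_mat_def split: if_splits)
  show "pattern_adj (arrow_mat t) v u" if "pattern_adj (arrow_mat t) u v" for u v
    using that by (cases u; cases v) auto
  show "depth u \<noteq> depth v" if "pattern_adj (arrow_mat t) u v" for u v
    using adj[OF that] by (auto simp: depth_def split: if_splits)
  show "v = w" if "pattern_adj (arrow_mat t) u v" "pattern_adj (arrow_mat t) u w"
    "depth v < depth u" "depth w < depth u" for u v w
    using adj[OF that(1)] adj[OF that(2)] that(3,4)
    by (auto simp: depth_def arrow_def split: if_splits)
qed

lemma contains_arrow_mat_iff:
  assumes "A \<in> carrier_mat n n"
  shows "arrow_mat t \<prec>\<^sub>p A \<longleftrightarrow>
    embeds arrow (2 * t) (2 * t + 1) n {(i, j). i < n \<and> j < n \<and> A $$ (i, j) = 1}"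
proof -
  have "(\<forall>i<2 * t. \<forall>j<2 * t + 1. arrow_mat t $$ (i, j) = 1 \<longrightarrow> A $$ (r i, c j) = 1) \<longleftrightarrow>
     (\<forall>i<2 * t. \<forall>j<2 * t + 1. arrow i j \<longrightarrow> (r i, c j) \<in> {(i, j). i < n \<and> j < n \<and> A $$ (i, j) = 1})"
    if "r ` {..<2 * t} \<subseteq> {..<n}" "c ` {..<2 * t + 1} \<subseteq> {..<n}" for r c :: "nat \<Rightarrow> nat"
    using that by (auto simp: arrow_mat_def image_subset_iff)
  moreover have "dim_row (arrow_mat t) = 2 * t" "dim_col (arrow_mat t) = 2 * t + 1"
    by (simp_all add: arrow_mat_def)
  moreover have "dim_row A = n" "dim_col A = n" using assms by auto
  ultimately show ?thesis unfolding contains_pattern_def embeds_def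
    by (simp only:) (intro ex_cong1 conj_cong refl; simp)
qed

section \<open>Transfer to the extremal function and the asymptotic upper bound\<close>

lemma extremal_arrow_mat_le:
  assumes "1 \<le> L" "n \<le> 2 ^ L" "1 \<le> t"
  shows "extremal (arrow_mat t) n \<le> 2 * n * (2 * L) ^ (4 * t - 3)"
proof -
  let ?S = "{num_ones A | A. A \<in> binary_mats n n \<and> \<not> arrow_mat t \<prec>\<^sub>p A}"
  \<comment> \<open>The corner 1 lets the zero matrix avoid the pattern, so the maximum ranges over
    a nonempty set.\<close>
  have "arrow_mat t $$ (0, 0) = 1" "0 < dim_row (arrow_mat t)" "0 < dim_col (arrow_mat t)"
    using assms(3) by (auto simp: arrow_mat_def arrow_def)
  from zero_mat_avoids[OF this(2,3,1), of n] have "?S \<noteq> {}" by blast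
  moreover have "num_ones A \<le> 2 * n * (2 * L) ^ (4 * t - 3)"
    if "A \<in> binary_mats n n" "\<not> arrow_mat t \<prec>\<^sub>p A" for A
  proof -
    have A: "A \<in> carrier_mat n n" using that by (simp add: binary_mats_def)
    let ?M = "{(i, j). i < n \<and> j < n \<and> A $$ (i, j) = 1}"
    have "\<not> embeds arrow (2 * t) (2 * t + 1) n ?M" using that contains_arrow_mat_iff[OF A] by simp
    moreover have "?M \<subseteq> {..<n} \<times> {..<n}" by auto
    ultimately have "card ?M \<le> 2 * n * (2 * L) ^ (4 * t - 3)"
      using weight_bound_arrow[OF assms] unfolding weight_bound_def by blast
    then show ?thesis using A by (simp add: num_ones_def)
  qed
  ultimately show ?thesis
    unfolding extremal_def using finite_num_ones_avoiding[of n "arrow_mat t"]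
    by (subst Max_le_iff) auto
qed

lemma card_le_extremal_arrow_mat:
  assumes "M \<subseteq> {..<n} \<times> {..<n}" "\<not> embeds arrow (2 * t) (2 * t + 1) n M"
  shows "card M \<le> extremal (arrow_mat t) n"
proof -
  define A :: "nat mat" where "A = mat n n (\<lambda>ij. if ij \<in> M then 1 else 0)"
  have A: "A \<in> carrier_mat n n" by (simp add: A_def)
  have M: "{(i, j). i < n \<and> j < n \<and> A $$ (i, j) = 1} = M"
    using assms(1) by (auto simp: A_def split: if_splits)
  have "A \<in> binary_mats n n" by (auto simp: binary_mats_def A_def)
  moreover have "\<not> arrow_mat t \<prec>\<^sub>p A" using assms(2) contains_arrow_mat_iff[OF A] M by simp
  moreover have "num_ones A = card M" using A M by (simp add: num_ones_def)
  ultimately show ?thesis unfolding extremal_def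
    using finite_num_ones_avoiding[of n "arrow_mat t"] by (intro Max_ge) force+
qed

lemma extremal_arrow_mat_bigo:
  assumes "1 \<le> t"
  shows "(\<lambda>n. real (extremal (arrow_mat t) n)) \<in> O(\<lambda>n. real n * ln (real n) ^ (4 * t - 3))"
proof (rule bigoI)
  show "\<forall>\<^sub>F n in at_top. norm (real (extremal (arrow_mat t) n))
      \<le> 2 * (4 / ln 2) ^ (4 * t - 3) * norm (real n * ln (real n) ^ (4 * t - 3))"
    using eventually_ge_at_top[of 2]
  proof eventually_elim
    case (elim n)
    \<comment> \<open>Rounding up at most doubles the logarithm once \<open>n \<ge> 2\<close>; hence
      the constant \<open>4 / ln 2\<close>.\<close>
    define L where "L = nat \<lceil>log 2 (real n)\<rceil>"
    have log1: "1 \<le> log 2 (real n)" using elim by simp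
    then have L1: "1 \<le> L" unfolding L_def by linarith
    have "real L \<le> log 2 (real n) + 1" unfolding L_def using log1 by linarith
    also have "\<dots> \<le> 2 * log 2 (real n)" using log1 by simp
    also have "\<dots> = 2 / ln 2 * ln (real n)" by (simp add: log_def)
    finally have L_le: "2 * real L \<le> 4 / ln 2 * ln (real n)" by simp
    have "log 2 (real n) \<le> real L" unfolding L_def using log1 by linarith
    then have "real n \<le> 2 powr real L" using elim by (simp add: log_le_iff)
    then have "real n \<le> real (2 ^ L)" by (simp add: powr_realpow)
    then have "n \<le> 2 ^ L" by (simp only: of_nat_le_iff)
    from extremal_arrow_mat_le[OF L1 this assms]
    have "real (extremal (arrow_mat t) n) \<le> real (2 * n * (2 * L) ^ (4 * t - 3))"
      by (simp only: of_nat_le_iff)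
    also have "\<dots> = 2 * real n * (2 * real L) ^ (4 * t - 3)" by simp
    also have "\<dots> \<le> 2 * real n * (4 / ln 2 * ln (real n)) ^ (4 * t - 3)"
      using L_le by (intro mult_left_mono power_mono) auto
    also have "\<dots> = 2 * (4 / ln 2) ^ (4 * t - 3) * (real n * ln (real n) ^ (4 * t - 3))"
      by (simp add: power_mult_distrib power_divide)
    finally show ?case using elim by (simp add: abs_mult)
  qed
qed

section \<open>A dense matrix avoiding the pattern\<close>

text \<open>A word \<open>k \<in> {0..<m} ^ t\<close> is encoded by a number whose base-\<open>B\<close> expansion has \<open>t\<close> nonzero
  digits. The position of the \<open>s\<close>-th one reveals \<open>k s\<close>, and the digit itself reveals all
  earlier letters. With all nonzero digits equal to 1 the codes of words \<open>(a, b)\<close> would be sums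
  \<open>x\<^sub>a + y\<^sub>b\<close>, and the matrix would contain every small pattern.\<close>

primrec prefix_code :: "nat \<Rightarrow> nat \<Rightarrow> (nat \<Rightarrow> nat) \<Rightarrow> nat" where
  "prefix_code m 0 k = 0"
| "prefix_code m (Suc s) k = prefix_code m s k * m + k s"

lemma prefix_code_cong:
  "(\<And>i. i < s \<Longrightarrow> k i = l i) \<Longrightarrow> prefix_code m s k = prefix_code m s l"
  by (induction s) auto

lemma prefix_code_less:
  "(\<And>i. i < s \<Longrightarrow> k i < m) \<Longrightarrow> prefix_code m s k < m ^ s"
proof (induction s)
  case (Suc s)
  then have "prefix_code m s k + 1 \<le> m ^ s" "k s < m" by (simp_all add: Suc_leI)
  then have "(prefix_code m s k + 1) * m \<le> m ^ s * m" by (intro mult_le_mono1)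
  then show ?case using \<open>k s < m\<close> by (simp add: algebra_simps)
qed simp

lemma prefix_code_inject:
  assumes "\<And>i. i < s \<Longrightarrow> k i < m" "\<And>i. i < s \<Longrightarrow> l i < m"
    and "prefix_code m s k = prefix_code m s l" "i < s"
  shows "k i = l i"
  using assms
proof (induction s)
  case (Suc s)
  have lt: "k s < m" "l s < m" using Suc.prems by auto
  have eq: "prefix_code m s k * m + k s = prefix_code m s l * m + l s" using Suc.prems(3) by simp
  from arg_cong[OF eq, of "\<lambda>x. x mod m"] have "k s = l s" using lt by simp
  moreover from this eq lt have "prefix_code m s k = prefix_code m s l" by auto
  ultimately show ?case using Suc by (cases "i = s") auto
qed simp

section \<open>Codes of words and the sizes of their differences\<close>

text \<open>There are \<open>t\<close> nonzero digits, each at most \<open>m ^ t\<close>, so this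
  \<open>B\<close> makes every part of a code below position \<open>e\<close> less than half of
  \<open>B ^ e\<close>.\<close>

locale word_codes =
  fixes t m B :: nat
  assumes B: "2 * t * m ^ t < B"
begin

definition words :: "(nat \<Rightarrow> nat) set" where
  "words = {..<t} \<rightarrow>\<^sub>E {..<m}"

text \<open>Each letter owns a block of \<open>m\<close> positions, earlier letters owning higher
  blocks, so the first difference of two words dominates.\<close>

definition level :: "nat \<Rightarrow> (nat \<Rightarrow> nat) \<Rightarrow> nat" where
  "level s k = (t - 1 - s) * m + k s"

text \<open>\<open>Suc\<close> keeps the digit nonzero, so its position stays visible. Letter
  \<open>s\<close> itself is left out, being recorded by the position.\<close>

definition digit :: "nat \<Rightarrow> (nat \<Rightarrow> nat) \<Rightarrow> nat" where
  "digit s k = Suc (prefix_code m s k)"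

definition code :: "(nat \<Rightarrow> nat) \<Rightarrow> nat" where
  "code k = (\<Sum>s<t. digit s k * B ^ level s k)"

definition drops_at :: "nat \<Rightarrow> (nat \<Rightarrow> nat) \<Rightarrow> (nat \<Rightarrow> nat) \<Rightarrow> bool" where
  "drops_at s k l \<longleftrightarrow> s < t \<and> (\<forall>i<s. k i = l i) \<and> l s < k s"

lemma words_less: "k \<in> words \<Longrightarrow> i < t \<Longrightarrow> k i < m"
  by (auto simp: words_def)

lemma digit_le:
  assumes "k \<in> words" "s < t" shows "digit s k \<le> m ^ t"
proof -
  have "digit s k \<le> m ^ s"
    unfolding digit_def Suc_le_eq by (rule prefix_code_less) (use assms words_less in auto)
  also have "\<dots> \<le> m ^ t" using words_less[OF assms] assms(2) by (intro power_increasing) auto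
  finally show ?thesis .
qed

lemma level_less:
  assumes "k \<in> words" "s < u" "u < t" shows "level u k < level s l"
proof -
  have "Suc (t - 1 - u) \<le> t - 1 - s" using assms by simp
  then have "Suc (t - 1 - u) * m \<le> (t - 1 - s) * m" by (rule mult_le_mono1)
  then show ?thesis using words_less[OF assms(1,3)] by (simp add: level_def)
qed

lemma sum_digits_less:
  assumes "k \<in> words" "S \<subseteq> {..<t}" "\<And>s. s \<in> S \<Longrightarrow> level s k < e"
  shows "2 * (\<Sum>s\<in>S. digit s k * B ^ level s k) < B ^ e"
proof (cases "S = {}")
  case True
  then show ?thesis using B by simp
next
  case False
  then obtain e' where e: "e = Suc e'" using assms(3) by (cases e) auto
  have "(\<Sum>s\<in>S. digit s k * B ^ level s k) \<le> card S * (m ^ t * B ^ e')"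
  proof (rule sum_bounded_above[where K = "m ^ t * B ^ e'", simplified])
    fix s assume "s \<in> S"
    then have "s < t" "level s k \<le> e'" using assms e by (auto simp: less_Suc_eq_le)
    then show "digit s k * B ^ level s k \<le> m ^ t * B ^ e'"
      using B digit_le[OF assms(1)] by (intro mult_le_mono power_increasing) auto
  qed
  also have "\<dots> \<le> t * (m ^ t * B ^ e')"
    using card_mono[OF _ assms(2)] by (intro mult_le_mono1) simp
  finally have "2 * (\<Sum>s\<in>S. digit s k * B ^ level s k) \<le> (2 * t * m ^ t) * B ^ e'" by simp
  also have "\<dots> < B * B ^ e'" using B by (intro mult_strict_right_mono) auto
  finally show ?thesis by (simp add: e)
qed

lemma code_less: "k \<in> words \<Longrightarrow> 2 * code k < B ^ (t * m)"
  unfolding code_def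
proof (rule sum_digits_less)
  fix s assume "k \<in> words" "s \<in> {..<t}"
  then have "k s < m" "s < t" using words_less by auto
  then have "level s k < Suc (t - 1 - s) * m" by (simp add: level_def)
  also have "\<dots> \<le> t * m" using \<open>s < t\<close> by (intro mult_le_mono1) simp
  finally show "level s k < t * m" .
qed auto

text \<open>The terms before \<open>s\<close> cancel, as they depend only on common letters. What
  remains besides the leading term, namely the tail of \<open>k\<close> and the terms of
  \<open>l\<close> from \<open>s\<close> on, lies at positions below \<open>level s k\<close>, and
  each of the two sums is less than half a unit \<open>B ^ level s k\<close>. Doubling avoids
  fractions.\<close>

lemma code_diff_approx:
  assumes "k \<in> words" "l \<in> words" "drops_at s k l"
  shows "2 * (int (code k) - int (code l)) < 2 * (int (digit s k) * int B ^ level s k) + int B ^ level s k"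
    and "2 * (int (digit s k) * int B ^ level s k) < 2 * (int (code k) - int (code l)) + int B ^ level s k"
proof -
  have s: "s < t" "\<And>i. i < s \<Longrightarrow> k i = l i" "l s < k s" using assms(3) by (auto simp: drops_at_def)
  have split: "code h = (\<Sum>u<s. digit u h * B ^ level u h) + (\<Sum>u\<in>{s..<t}. digit u h * B ^ level u h)" for h
    unfolding code_def using s(1)
    by (metis (no_types, lifting) atLeast0LessThan less_imp_le_nat sum.atLeastLessThan_concat zero_le)
  have split': "(\<Sum>u\<in>{s..<t}. digit u k * B ^ level u k) =
      digit s k * B ^ level s k + (\<Sum>u\<in>{Suc s..<t}. digit u k * B ^ level u k)"
    using s(1) by (simp add: sum.atLeast_Suc_lessThan)
  have "(\<Sum>u<s. digit u k * B ^ level u k) = (\<Sum>u<s. digit u l * B ^ level u l)"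
    using s(2) by (intro sum.cong) (auto simp: digit_def level_def intro!: prefix_code_cong)
  moreover have "2 * (\<Sum>u\<in>{Suc s..<t}. digit u k * B ^ level u k) < B ^ level s k"
    by (rule sum_digits_less[OF assms(1)]) (auto intro: level_less[OF assms(1)])
  moreover have "2 * (\<Sum>u\<in>{s..<t}. digit u l * B ^ level u l) < B ^ level s k"
  proof (rule sum_digits_less[OF assms(2)])
    fix u assume "u \<in> {s..<t}"
    then show "level u l < level s k"
      using level_less[OF assms(2), of s u k] s(3) by (cases "u = s") (auto simp: level_def)
  qed auto
  ultimately have "2 * code k < 2 * code l + 2 * (digit s k * B ^ level s k) + B ^ level s k"
    "2 * code l + 2 * (digit s k * B ^ level s k) < 2 * code k + B ^ level s k"
    using split[of k] split[of l] split' by linarith+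
  then have "int (2 * code k) < int (2 * code l + 2 * (digit s k * B ^ level s k) + B ^ level s k)"
    "int (2 * code l + 2 * (digit s k * B ^ level s k)) < int (2 * code k + B ^ level s k)"
    by (simp_all only: of_nat_less_iff)
  then show "2 * (int (code k) - int (code l)) < 2 * (int (digit s k) * int B ^ level s k) + int B ^ level s k"
    "2 * (int (digit s k) * int B ^ level s k) < 2 * (int (code k) - int (code l)) + int B ^ level s k"
    by simp_all
qed

text \<open>The leading term is at least one unit and the error less than half of it. Thus codes are
  ordered as their words are lexicographically.\<close>

lemma drops_at_imp_code_less:
  assumes "k \<in> words" "l \<in> words" "drops_at s k l" shows "code l < code k"
proof -
  define P where "P = int B ^ level s k"
  have "0 < P" using B by (simp add: P_def)
  define E where "E = int (digit s k) * P"
  have "P \<le> E" using \<open>0 < P\<close> by (simp add: E_def digit_def)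
  moreover have "2 * E < 2 * (int (code k) - int (code l)) + P"
    using code_diff_approx(2)[OF assms] by (simp add: P_def E_def)
  ultimately have "int (code l) < int (code k)" using \<open>0 < P\<close> by presburger
  then show ?thesis by simp
qed

lemma ex_drops_at:
  assumes "k \<in> words" "l \<in> words" "k \<noteq> l"
  shows "\<exists>s. drops_at s k l \<or> drops_at s l k"
proof -
  have ex: "\<exists>i. i < t \<and> k i \<noteq> l i" using assms unfolding words_def by (metis PiE_ext lessThan_iff)
  define s where "s = (LEAST i. i < t \<and> k i \<noteq> l i)"
  have s: "s < t" "k s \<noteq> l s" using LeastI_ex[OF ex] by (auto simp: s_def)
  have "k i = l i" if "i < s" for i
    using not_less_Least[of i "\<lambda>i. i < t \<and> k i \<noteq> l i"] that s(1) by (auto simp: s_def)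
  then show ?thesis using s unfolding drops_at_def by (metis linorder_neqE_nat)
qed

lemma inj_on_code: "inj_on code words"
  by (rule inj_onI) (metis ex_drops_at drops_at_imp_code_less nat_less_le)

lemma code_less_imp_drops_at:
  assumes "k \<in> words" "l \<in> words" "code l < code k"
  obtains s where "drops_at s k l"
  using ex_drops_at[OF assms(1,2)] drops_at_imp_code_less[OF assms(2,1)] assms(3)
  by (metis not_less_iff_gr_or_eq)

text \<open>A higher leading position wins against any digit because \<open>B\<close> exceeds twice
  the digit. At equal positions different digits are told apart, since the half-unit intervals
  around their multiples of the unit are disjoint; equal digits leave the comparison to lower
  terms.\<close>

lemma code_diff_less_imp_lex:
  assumes k: "k \<in> words" "k' \<in> words" "drops_at s k k'"
    and l: "l \<in> words" "l' \<in> words" "drops_at u l l'"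
    and less: "int (code k) - int (code k') < int (code l) - int (code l')"
  shows "u < s \<or> u = s \<and> (k s < l s \<or> k s = l s \<and> digit s k \<le> digit s l)"
proof -
  have st: "s < t" "u < t" using k(3) l(3) by (auto simp: drops_at_def)
  define P where "P = int B ^ level s k"
  define Q where "Q = int B ^ level u l"
  have approx: "2 * (int (digit s k) * P) < 2 * (int (code k) - int (code k')) + P"
    "2 * (int (code l) - int (code l')) < 2 * (int (digit u l) * Q) + Q"
    using code_diff_approx(2)[OF k] code_diff_approx(1)[OF l] by (simp_all add: P_def Q_def)
  have PQ: "0 < P" "0 < Q" using B by (simp_all add: P_def Q_def)
  have le: "level s k \<le> level u l"
  proof (rule ccontr)
    assume "\<not> level s k \<le> level u l"
    then have "int B ^ Suc (level u l) \<le> int B ^ level s k" using B by (intro power_increasing) auto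
    then have "Q * int B \<le> P" by (simp add: P_def Q_def mult.commute)
    moreover have "m ^ t \<le> t * m ^ t" using st by simp
    then have "2 * digit u l + 1 \<le> B" using digit_le[OF l(1) st(2)] B by linarith
    then have "Q * (2 * int (digit u l) + 1) \<le> Q * int B" using PQ by (intro mult_left_mono) auto
    moreover have "1 * P \<le> int (digit s k) * P" using PQ
      by (intro mult_right_mono) (auto simp: digit_def)
    ultimately show False using approx less by (simp add: algebra_simps)
  qed
  then have "u \<le> s" using level_less[OF l(1) _ st(2), of s k] by (meson linorder_not_le)
  show ?thesis
  proof (cases "u = s \<and> k s = l s")
    case True
    have "digit s k \<le> digit s l"
    proof (rule ccontr)
      assume "\<not> ?thesis"
      then have "(int (digit s l) + 1) * P \<le> int (digit s k) * P" using PQ by (intro mult_right_mono) auto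
      moreover have "Q = P" using True by (simp add: P_def Q_def level_def)
      ultimately show False using approx less True by (simp add: algebra_simps)
    qed
    then show ?thesis using True by simp
  next
    case False
    then show ?thesis using \<open>u \<le> s\<close> le by (auto simp: level_def)
  qed
qed

text \<open>The sandwiched differences give \<open>a' \<le> w \<le> a \<le> s\<close> for the
  indices of the drops. If \<open>a' = s\<close>, all three are equal, and so are the letters and
  digits there; then \<open>k\<close> and \<open>l\<close> agree up to and including
  \<open>s\<close>, against their drop at \<open>b \<le> s\<close>.\<close>

lemma drops_at_earlier:
  assumes W: "k \<in> words" "k1 \<in> words" "k2 \<in> words" "l \<in> words" "l1 \<in> words"
    and k1: "drops_at a k k1" "a \<le> s" and l: "drops_at b k l" "b \<le> s"
    and less1: "int (code k) - int (code k1) < int (code l) - int (code l1)"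
    and less2: "int (code l) - int (code l1) < int (code k) - int (code k2)"
  shows "\<exists>a'<s. drops_at a' k k2"
proof -
  have pos: "code k1 < code k" using drops_at_imp_code_less W k1 by blast
  then obtain w where w: "drops_at w l l1"
    using code_less_imp_drops_at[OF W(4,5)] less1 by auto
  obtain a' where a': "drops_at a' k k2"
    using code_less_imp_drops_at[OF W(1,3)] pos less1 less2 by auto
  note lex1 = code_diff_less_imp_lex[OF W(1,2) k1(1) W(4,5) w less1]
  note lex2 = code_diff_less_imp_lex[OF W(4,5) w W(1,3) a' less2]
  have "a' < s"
  proof (rule ccontr)
    assume "\<not> a' < s"
    then have eq: "a' = s" "w = s" "a = s" using lex1 lex2 k1(2) by auto
    have "k s = l s" "digit s k = digit s l" using lex1 lex2 eq by auto
    moreover have "s < t" using k1(1) eq by (simp add: drops_at_def)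
    ultimately have "k i = l i" if "i < s" for i
      using prefix_code_inject[of s k m l i] words_less W(1,4) that by (simp add: digit_def)
    then show False using l \<open>k s = l s\<close> by (auto simp: drops_at_def le_less)
  qed
  then show ?thesis using a' by blast
qed

text \<open>This ends the descent: a larger difference for \<open>l\<close> would have to start at
  letter 0 with \<open>k 0 \<le> l 0\<close>.\<close>

lemma not_drops_at_first_letter:
  assumes W: "k \<in> words" "k1 \<in> words" "l \<in> words" "l1 \<in> words"
    and k1: "drops_at 0 k k1" and l: "drops_at 0 k l"
  shows "\<not> int (code k) - int (code k1) < int (code l) - int (code l1)"
proof
  assume less: "int (code k) - int (code k1) < int (code l) - int (code l1)"
  have "code k1 < code k" using drops_at_imp_code_less W k1 by blast
  then obtain w where w: "drops_at w l l1"
    using code_less_imp_drops_at[OF W(3,4)] less by auto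
  from code_diff_less_imp_lex[OF W(1,2) k1 W(3,4) w less] l show False
    by (auto simp: drops_at_def)
qed

section \<open>The matrix built from the codes and its avoidance of the pattern\<close>

definition code_matrix :: "nat \<Rightarrow> (nat \<times> nat) set" where
  "code_matrix n = {(i, j). i < n \<and> j < n \<and> (\<exists>k\<in>words. i + j + code k + 1 = n)}"

lemma code_matrix_avoids_arrow:
  assumes "1 \<le> t"
  shows "\<not> embeds arrow (2 * t) (2 * t + 1) n (code_matrix n)"
proof
  assume "embeds arrow (2 * t) (2 * t + 1) n (code_matrix n)"
  then obtain r c where r: "strict_mono_on {..<2 * t} r" and c: "strict_mono_on {..<2 * t + 1} c"
    and in_M: "\<forall>i<2 * t. \<forall>j<2 * t + 1. arrow i j \<longrightarrow> (r i, c j) \<in> code_matrix n"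
    unfolding embeds_def by (elim exE conjE)
  have "\<forall>i j. \<exists>k. i < 2 * t \<and> j < 2 * t + 1 \<and> arrow i j \<longrightarrow> k \<in> words \<and> r i + c j + code k + 1 = n"
    using in_M by (fastforce simp: code_matrix_def)
  then obtain K where K: "\<forall>i j. i < 2 * t \<and> j < 2 * t + 1 \<and> arrow i j \<longrightarrow>
      K i j \<in> words \<and> r i + c j + code (K i j) + 1 = n"
    by (metis (no_types))
  have K_words: "K i j \<in> words" and K_code: "int (code (K i j)) = int n - 1 - int (r i) - int (c j)"
    if "i < 2 * t" "j < 2 * t + 1" "arrow i j" for i j
    using K that by force+
  have r_less: "r i < r i'" if "i < i'" "i' < 2 * t" for i i'
    using strict_mono_onD[OF r, of i i'] that by auto
  have c_less: "c i < c i'" if "i < i'" "i' < 2 * t + 1" for i i'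
    using strict_mono_onD[OF c, of i i'] that by auto
  have arrow: "arrow 0 0" "\<And>i. arrow 0 (Suc (2 * i))" "\<And>i. arrow (Suc (2 * i)) 0"
    "\<And>i. arrow (Suc (2 * i)) (Suc (Suc (2 * i)))" "\<And>i. arrow (Suc (Suc (2 * i))) (Suc (2 * i))"
    by (auto simp: arrow_def)
  \<comment> \<open>Round \<open>i\<close> concerns the odd index \<open>2 * i + 1\<close>: in both
    arms the word there drops from the corner word at an index that decreases with each
    round.\<close>
  have inv: "(\<exists>a\<le>t - 1 - i. drops_at a (K 0 0) (K 0 (Suc (2 * i)))) \<and>
      (\<exists>b\<le>t - 1 - i. drops_at b (K 0 0) (K (Suc (2 * i)) 0))" if "i < t" for i
    using that
  proof (induction i)
    case 0
    have "code (K 0 (Suc 0)) < code (K 0 0)"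
      using K_code[of 0 0] K_code[of 0 "Suc 0"] arrow(2)[of 0] arrow(1) c_less[of 0 "Suc 0"] 0 by simp
    then obtain a where a: "drops_at a (K 0 0) (K 0 (Suc 0))"
      using code_less_imp_drops_at[of "K 0 0" "K 0 (Suc 0)"] K_words[of 0 0] K_words[of 0 "Suc 0"] arrow(1) arrow(2)[of 0] 0
      by auto
    have "code (K (Suc 0) 0) < code (K 0 0)"
      using K_code[of 0 0] K_code[of "Suc 0" 0] arrow(3)[of 0] arrow(1) r_less[of 0 "Suc 0"] 0 by simp
    then obtain b where b: "drops_at b (K 0 0) (K (Suc 0) 0)"
      using code_less_imp_drops_at[of "K 0 0" "K (Suc 0) 0"] K_words[of 0 0] K_words[of "Suc 0" 0] arrow(1) arrow(3)[of 0] 0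
      by auto
    have "a \<le> t - 1" "b \<le> t - 1" using a b by (auto simp: drops_at_def)
    then show ?case using a b by auto
  next
    case (Suc i)
    then obtain a b where
      a: "drops_at a (K 0 0) (K 0 (Suc (2 * i)))" "a \<le> t - 1 - i" and
      b: "drops_at b (K 0 0) (K (Suc (2 * i)) 0)" "b \<le> t - 1 - i" by auto
    let ?p = "Suc (2 * i)" and ?q = "Suc (Suc (2 * i))" and ?p' = "Suc (2 * Suc i)"
    have bounds: "?p < 2 * t" "?q < 2 * t" "?p' < 2 * t" "?p < 2 * t + 1" "?q < 2 * t + 1" "?p' < 2 * t + 1"
      "0 < 2 * t" "0 < 2 * t + 1" using Suc.prems by auto
    have W: "K 0 0 \<in> words" "K 0 ?p \<in> words" "K ?p 0 \<in> words" "K ?p ?q \<in> words" "K ?q ?p \<in> words"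
      "K 0 ?p' \<in> words" "K ?p' 0 \<in> words"
      by (intro K_words bounds arrow)+
    note codes = K_code[OF bounds(7,8) arrow(1)] K_code[OF bounds(7,4) arrow(2)]
      K_code[OF bounds(1,8) arrow(3)] K_code[OF bounds(1,5) arrow(4)] K_code[OF bounds(2,4) arrow(5)]
      K_code[OF bounds(7,6) arrow(2)] K_code[OF bounds(3,8) arrow(3)]
    have "c ?p < c ?q" "c ?q < c ?p'" "r ?p < r ?q" "r ?q < r ?p'"
      using Suc.prems by (auto intro!: r_less c_less)
    \<comment> \<open>Code differences within row 0 and row \<open>?p\<close> are distances from
      column 0 to \<open>?p\<close>, \<open>?q\<close> and \<open>?p'\<close>, in increasing order.
      The word at \<open>(?p, 0)\<close> plays \<open>l\<close> for the row arm, and the word at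
      \<open>(0, ?p)\<close> plays \<open>l\<close> for the column arm.\<close>
    then have "\<exists>a'<t - 1 - i. drops_at a' (K 0 0) (K 0 ?p')" "\<exists>b'<t - 1 - i. drops_at b' (K 0 0) (K ?p' 0)"
      using drops_at_earlier[OF W(1,2,6,3,4) a b] drops_at_earlier[OF W(1,3,7,2,5) b a] codes
      by simp_all
    moreover have "a' \<le> t - 1 - Suc i" if "a' < t - 1 - i" for a' using that by simp
    ultimately show ?case by blast
  qed
  \<comment> \<open>In the last round both drops are at letter 0. Only the entry at
    \<open>(?p, ?q)\<close> is still needed, where \<open>?q = 2 * t\<close> is the extra column of
    the pattern.\<close>
  obtain i where i: "t = Suc i" using assms by (cases t) auto
  let ?p = "Suc (2 * i)" and ?q = "Suc (Suc (2 * i))"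
  have bounds: "?p < 2 * t" "?p < 2 * t + 1" "?q < 2 * t + 1" "0 < 2 * t" "0 < 2 * t + 1"
    using i by auto
  have "drops_at 0 (K 0 0) (K 0 ?p)" "drops_at 0 (K 0 0) (K ?p 0)" using inv[of i] i by auto
  moreover have "K 0 0 \<in> words" "K 0 ?p \<in> words" "K ?p 0 \<in> words" "K ?p ?q \<in> words"
    by (intro K_words bounds arrow)+
  moreover have "c ?p < c ?q" using bounds by (intro c_less) auto
  ultimately show False
    using not_drops_at_first_letter[of "K 0 0" "K 0 ?p" "K ?p 0" "K ?p ?q"]
      K_code[OF bounds(4,5) arrow(1)] K_code[OF bounds(4,2) arrow(2)]
      K_code[OF bounds(1,5) arrow(3)] K_code[OF bounds(1,3) arrow(4)]
    by simp
qed

text \<open>Codes are distinct and below \<open>n / 2\<close>, so each of the first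
  \<open>n div 2\<close> rows has a separate 1 for every word.\<close>

lemma card_code_matrix_ge:
  assumes "B ^ (t * m) \<le> n"
  shows "m ^ t * (n div 2) \<le> card (code_matrix n)"
proof -
  let ?f = "\<lambda>(k, i). (i, n - 1 - i - code k)"
  have lt: "i + code k + 1 \<le> n" if "k \<in> words" "i < n div 2" for k i
    using code_less[OF that(1)] that(2) assms by linarith
  have "inj_on ?f (words \<times> {..<n div 2})"
  proof (rule inj_onI, clarsimp)
    fix k l i assume "k \<in> words" "l \<in> words" "i < n div 2"
      "n - Suc (i + code k) = n - Suc (i + code l)"
    then have "code k = code l" using lt[of k i] lt[of l i] by linarith
    then show "k = l" using inj_on_code \<open>k \<in> words\<close> \<open>l \<in> words\<close> by (auto dest: inj_onD)
  qed
  moreover have "?f ` (words \<times> {..<n div 2}) \<subseteq> code_matrix n"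
  proof -
    have "(i, n - 1 - i - code k) \<in> code_matrix n" if "k \<in> words" "i < n div 2" for k i
      using lt[OF that] that by (auto simp: code_matrix_def intro!: bexI[of _ k])
    then show ?thesis by auto
  qed
  moreover have "finite (code_matrix n)"
    by (rule finite_subset[of _ "{..<n} \<times> {..<n}"]) (auto simp: code_matrix_def)
  ultimately have "card (words \<times> {..<n div 2}) \<le> card (code_matrix n)" by (rule card_inj_on_le)
  then show ?thesis by (simp add: words_def card_PiE card_cartesian_product)
qed

end

section \<open>The asymptotic lower bound\<close>

lemma extremal_arrow_mat_ge:
  assumes "1 \<le> t" "(4 * t * m ^ t) ^ (t * m) \<le> n" "1 \<le> m"
  shows "m ^ t * (n div 2) \<le> extremal (arrow_mat t) n"
proof -
  interpret word_codes t m "4 * t * m ^ t" by unfold_locales (use assms in simp)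
  have "m ^ t * (n div 2) \<le> card (code_matrix n)" by (rule card_code_matrix_ge[OF assms(2)])
  also have "\<dots> \<le> extremal (arrow_mat t) n"
    by (rule card_le_extremal_arrow_mat[OF _ code_matrix_avoids_arrow[OF assms(1)]])
      (auto simp: code_matrix_def)
  finally show ?thesis .
qed

lemma extremal_arrow_mat_bigomega:
  assumes t: "1 \<le> t"
  shows "(\<lambda>n. real (extremal (arrow_mat t) n)) \<in> \<Omega>(\<lambda>n. real n * (ln (real n) / ln (ln (real n))) ^ t)"
proof -
  \<comment> \<open>The logarithm of \<open>(4 * t * m ^ t) ^ (t * m)\<close> is
    \<open>t * m * (ln (4 * t) + t * ln m)\<close>. Both summands will be at most
    \<open>t * ln (ln n)\<close>, so \<open>m * C * ln (ln n) \<le> ln n\<close> makes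
    \<open>n\<close> large enough.\<close>
  define C where "C = 2 * (real t)\<^sup>2"
  have C: "C > 0" using t by (simp add: C_def)
  have "\<forall>\<^sub>F n in at_top. ln (ln (real n)) \<ge> 1 \<and> ln (ln (real n)) \<ge> ln (4 * real t)
      \<and> ln (real n) / (C * ln (ln (real n))) \<ge> 2 \<and> real n \<ge> 2"
    (is "eventually ?P _")
    using C by (intro eventually_conj) real_asymp+
  then have "\<forall>\<^sub>F n in at_top. norm (real n * (ln (real n) / ln (ln (real n))) ^ t)
      \<le> 4 * (2 * C) ^ t * norm (real (extremal (arrow_mat t) n))"
  proof eventually_elim
    case (elim n)
    define x where "x = ln (real n) / (C * ln (ln (real n)))"
    define m where "m = nat \<lfloor>x\<rfloor>"
    have lnln: "ln (ln (real n)) \<ge> 1" "ln (ln (real n)) \<ge> ln (4 * real t)" and x2: "x \<ge> 2" and n2: "n \<ge> 2"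
      using elim by (auto simp: x_def)
    have ln_pos: "ln (real n) > 0" using n2 by simp
    have m: "1 \<le> m" "real m \<le> x" "x \<le> 2 * real m" unfolding m_def using x2 by linarith+
    have "1 \<le> C * ln (ln (real n))"
    proof -
      have "1 \<le> (real t)\<^sup>2" using t by (intro one_le_power) simp
      then have "1 * 1 \<le> C * ln (ln (real n))" using lnln by (intro mult_mono) (auto simp: C_def)
      then show ?thesis by simp
    qed
    then have "x \<le> ln (real n)" using ln_pos unfolding x_def by (simp add: divide_le_eq mult_le_cancel_left1)
    then have ln_m: "ln (real m) \<le> ln (ln (real n))" using m by (subst ln_le_cancel_iff) auto
    have "ln (real ((4 * t * m ^ t) ^ (t * m))) = real t * real m * (ln (4 * real t) + real t * ln (real m))"
      using t m by (simp add: ln_realpow ln_mult)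
    also have "\<dots> \<le> real t * x * (real t * ln (ln (real n)) + real t * ln (ln (real n)))"
    proof (intro mult_mono add_mono)
      show "ln (4 * real t) \<le> real t * ln (ln (real n))"
      proof -
        have "1 * ln (ln (real n)) \<le> real t * ln (ln (real n))"
          using lnln t by (intro mult_right_mono) auto
        with lnln(2) show ?thesis unfolding mult_1 by (rule order_trans)
      qed
    qed (use m t ln_m lnln in auto)
    also have "\<dots> = x * (C * ln (ln (real n)))" by (simp add: C_def power2_eq_square)
    also have "\<dots> = ln (real n)" using C lnln by (simp add: x_def)
    finally have "real ((4 * t * m ^ t) ^ (t * m)) \<le> real n"
      using t m n2 by (subst (asm) ln_le_cancel_iff) auto
    then have "(4 * t * m ^ t) ^ (t * m) \<le> n" by (simp only: of_nat_le_iff)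
    from extremal_arrow_mat_ge[OF t this m(1)]
    have "real (m ^ t * (n div 2)) \<le> real (extremal (arrow_mat t) n)" by (simp only: of_nat_le_iff)
    then have ext: "real m ^ t * real (n div 2) \<le> real (extremal (arrow_mat t) n)" by simp
    have "real n * (ln (real n) / ln (ln (real n))) ^ t = real n * (C * x) ^ t"
      using C by (simp add: x_def)
    \<comment> \<open>Both roundings lose a bounded factor: \<open>n \<le> 4 * (n div 2)\<close> for
      \<open>n \<ge> 2\<close>, and \<open>x \<le> 2 * m\<close>.\<close>
    also have "\<dots> \<le> (4 * real (n div 2)) * (C * (2 * real m)) ^ t"
      using n2 m C x2 by (intro mult_mono power_mono mult_left_mono) auto
    also have "\<dots> = 4 * (2 * C) ^ t * (real m ^ t * real (n div 2))"
      by (simp add: power_mult_distrib)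
    also have "\<dots> \<le> 4 * (2 * C) ^ t * real (extremal (arrow_mat t) n)"
      using ext C by (intro mult_left_mono) auto
    finally show ?case using ln_pos lnln by (simp add: abs_mult power_abs)
  qed
  then show ?thesis by (simp add: bigomega_iff_bigo bigoI)
qed

theorem theorem1:
  fixes t :: nat
  assumes "t \<ge> 2"
  shows "\<exists>X. X \<in> binary_mats (2 * t) (2 * t + 1) \<and> acyclic_pattern X \<and>
    (\<lambda>n. real (extremal X n)) \<in> \<Omega>(\<lambda>n. real n * (ln (real n) / ln (ln (real n))) ^ t) \<and>
    (\<lambda>n. real (extremal X n)) \<in> O(\<lambda>n. real n * ln (real n) ^ (4 * t - 3))"
proof -
  have "1 \<le> t" using assms by simp
  then show ?thesis
    using arrow_mat_binary acyclic_arrow_mat extremal_arrow_mat_bigomega extremal_arrow_mat_bigo by blast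
qed

end
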